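(* For $\varphi\in L^\infty(\mathbb{T})$, the operator $D_\varphi^{\mathcal{M}}$ is compact on $\mathcal{M}^\perp$ if and only if $\varphi=0$ almost everywhere on $\mathbb{T}$.
   Context: $\mathbb{D}$ is the open unit disk, $\mathbb{T}=\partial\mathbb{D}$, and $L^2(\mathbb{T})$ is taken with respect to normalized Lebesgue measure $m$, with inner product linear in the first variable. $H^2\subset L^2(\mathbb{T})$ is the Hardy space (functions with vanishing negative Fourier coefficients, also viewed as analytic functions on $\mathbb{D}$). For $f\in H^2$, $S^*f=(f-f(0))/z$. For an inner function $u$, $\mathcal{K}_u=H^2\ominus uH^2$. A closed subspace $\mathcal{M}\subset H^2$ is nearly $S^*$-invariant if $f\in\mathcal{M}$, $f(0)=0$ imply $S^*f\in\mathcal{M}$. Setting: $\mathcal{M}=h\mathcal{K}_u$ is a nonzero proper closed nearly $S^*$-invariant subspace of $H^2$, where $u$ is a nonconstant inner function with $u(0)=0$ and $h\in\mathcal{M}$ is the extremal function of $\mathcal{M}$: $\|h\|_2=1$, $h(0)>0$, $h\perp\{f\in\mathcal{M}:f(0)=0\}$, and multiplication by $h$ is an isometry from $\mathcal{K}_u$ onto $\mathcal{M}$. The orthogonal complement is $\mathcal{M}^\perp=L^2(\mathbb{T})\ominus\mathcal{M}$, and $P_{\mathcal{M}^\perp}$ is the orthogonal projection of $L^2(\mathbb{T})$ onto it. For $\varphi\in L^\infty(\mathbb{T})$, $D_\varphi^{\mathcal{M}}:\mathcal{M}^\perp\to\mathcal{M}^\perp$ is defined by $D_\varphi^{\mathcal{M}}f=P_{\mathcal{M}^\perp}(\varphi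 f)$. *)

theory Defs
  imports "HOL-Analysis.Analysis"
begin

text \<open>
  Elements of \<open>L\<^sup>2(\<T>)\<close> are represented by measurable functions, and sets of such functions stand for
  subspaces of \<open>L\<^sup>2(\<T>)\<close>.  Equality in \<open>L\<^sup>2(\<T>)\<close> is equality almost everywhere.  Only the values of a
  function on the unit circle matter.
\<close>

definition circle_measure :: "complex measure" where
  "circle_measure = distr (uniform_measure lborel {0..2*pi}) (restrict_space borel (sphere 0 1)) cis"

definition L2 :: "(complex \<Rightarrow> complex) set" where
  "L2 = {f \<in> borel_measurable circle_measure. integrable circle_measure (\<lambda>z. (norm (f z))\<^sup>2)}"

definition Linfty :: "(complex \<Rightarrow> complex) set" where
  "Linfty = {f \<in> borel_measurable circle_measure. \<exists>C. AE z in circle_measure. norm (f z) \<le> C}"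

definition L2_inner :: "(complex \<Rightarrow> complex) \<Rightarrow> (complex \<Rightarrow> complex) \<Rightarrow> complex" where
  "L2_inner f g = (LINT z|circle_measure. f z * cnj (g z))"

definition L2_norm :: "(complex \<Rightarrow> complex) \<Rightarrow> real" where
  "L2_norm f = sqrt (LINT z|circle_measure. (norm (f z))\<^sup>2)"

definition ominus :: "(complex \<Rightarrow> complex) set \<Rightarrow> (complex \<Rightarrow> complex) set \<Rightarrow> (complex \<Rightarrow> complex) set" where
  "ominus A B = {f \<in> A. \<forall>g\<in>B. L2_inner f g = 0}"

definition L2_subspace :: "(complex \<Rightarrow> complex) set \<Rightarrow> bool" where
  "L2_subspace M \<longleftrightarrow> M \<subseteq> L2 \<and> (\<lambda>z. 0) \<in> M \<and>
     (\<forall>f\<in>M. \<forall>g\<in>M. (\<lambda>z. f z + g z) \<in> M) \<and> (\<forall>c. \<forall>f\<in>M. (\<lambda>z. c * f z) \<in> M)"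

text \<open>Closedness includes saturation: a function in \<open>L2\<close> that agrees almost everywhere with an
  element of \<open>M\<close> is itself in \<open>M\<close> (take a constant sequence).\<close>

definition L2_closed :: "(complex \<Rightarrow> complex) set \<Rightarrow> bool" where
  "L2_closed M \<longleftrightarrow> (\<forall>F g. (\<forall>n::nat. F n \<in> M) \<and> g \<in> L2 \<and>
     (\<lambda>n. L2_norm (\<lambda>z. F n z - g z)) \<longlonglongrightarrow> 0 \<longrightarrow> g \<in> M)"

definition fourier_coeff :: "(complex \<Rightarrow> complex) \<Rightarrow> int \<Rightarrow> complex" where
  "fourier_coeff f n = L2_inner f (\<lambda>z. z powi n)"

definition H2 :: "(complex \<Rightarrow> complex) set" where
  "H2 = {f \<in> L2. \<forall>n<0. fourier_coeff f n = 0}"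

text \<open>The analytic function on the unit disk associated with \<open>f \<in> H2\<close>.  The function \<open>f\<close> itself only
  carries the boundary values, so \<open>f(0)\<close> in the sense of Hardy spaces is \<open>disk_ext f 0\<close>.\<close>

definition disk_ext :: "(complex \<Rightarrow> complex) \<Rightarrow> complex \<Rightarrow> complex" where
  "disk_ext f w = (\<Sum>n. fourier_coeff f (int n) * w ^ n)"

definition backward_shift :: "(complex \<Rightarrow> complex) \<Rightarrow> complex \<Rightarrow> complex" where
  "backward_shift f = (\<lambda>z. (f z - disk_ext f 0) / z)"

definition nearly_invariant :: "(complex \<Rightarrow> complex) set \<Rightarrow> bool" where
  "nearly_invariant M \<longleftrightarrow> (\<forall>f\<in>M. disk_ext f 0 = 0 \<longrightarrow> backward_shift f \<in> M)"

definition inner_function :: "(complex \<Rightarrow> complex) \<Rightarrow> bool" where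
  "inner_function u \<longleftrightarrow> u \<in> H2 \<and> (AE z in circle_measure. norm (u z) = 1)"

definition model_space :: "(complex \<Rightarrow> complex) \<Rightarrow> (complex \<Rightarrow> complex) set" where
  "model_space u = ominus H2 {\<lambda>z. u z * g z | g. g \<in> H2}"

text \<open>Multiplication by \<open>h\<close> maps \<open>K\<close> isometrically onto \<open>M\<close>; when \<open>M\<close> is
  closed this includes \<open>M = hK\<close>.\<close>

definition mult_isometry_onto ::
  "(complex \<Rightarrow> complex) \<Rightarrow> (complex \<Rightarrow> complex) set \<Rightarrow> (complex \<Rightarrow> complex) set \<Rightarrow> bool" where
  "mult_isometry_onto h K M \<longleftrightarrow>
     (\<forall>k\<in>K. (\<lambda>z. h z * k z) \<in> M \<and> L2_norm (\<lambda>z. h z * k z) = L2_norm k) \<and>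
     (\<forall>f\<in>M. \<exists>k\<in>K. AE z in circle_measure. f z = h z * k z)"

definition extremal_function :: "(complex \<Rightarrow> complex) \<Rightarrow> (complex \<Rightarrow> complex) set \<Rightarrow> bool" where
  "extremal_function h M \<longleftrightarrow> h \<in> M \<and> L2_norm h = 1 \<and>
     Im (disk_ext h 0) = 0 \<and> Re (disk_ext h 0) > 0 \<and>
     (\<forall>f\<in>M. disk_ext f 0 = 0 \<longrightarrow> L2_inner h f = 0)"

text \<open>For a closed subspace \<open>N\<close> and \<open>f \<in> L2\<close> the function \<open>g\<close> below exists and is unique up to
  equality almost everywhere.\<close>

definition orth_proj ::
  "(complex \<Rightarrow> complex) set \<Rightarrow> (complex \<Rightarrow> complex) \<Rightarrow> complex \<Rightarrow> complex" where
  "orth_proj N f = (SOME g. g \<in> N \<and> (\<forall>k\<in>N. L2_inner (\<lambda>z. f z - g z) k = 0))"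

definition dual_toeplitz ::
  "(complex \<Rightarrow> complex) set \<Rightarrow> (complex \<Rightarrow> complex) \<Rightarrow> (complex \<Rightarrow> complex) \<Rightarrow> complex \<Rightarrow> complex" where
  "dual_toeplitz M \<phi> f = orth_proj (ominus L2 M) (\<lambda>z. \<phi> z * f z)"

definition compact_operator_on ::
  "(complex \<Rightarrow> complex) set \<Rightarrow> ((complex \<Rightarrow> complex) \<Rightarrow> complex \<Rightarrow> complex) \<Rightarrow> bool" where
  "compact_operator_on N T \<longleftrightarrow>
     (\<forall>F. (\<forall>n::nat. F n \<in> N) \<and> (\<exists>C. \<forall>n. L2_norm (F n) \<le> C) \<longrightarrow>
        (\<exists>g\<in>N. \<exists>r. strict_mono (r :: nat \<Rightarrow> nat) \<and>
           (\<lambda>n. L2_norm (\<lambda>z. T (F (r n)) z - g z)) \<longlonglongrightarrow> 0))"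

end

theory Submission
  imports Defs "HOL-Probability.Probability_Measure"
begin

text \<open>
  Why a compact \<open>D = D\<^sub>\<phi>\<close> has \<open>\<phi> = 0\<close>. Since \<open>M\<close> consists of functions in \<open>H\<^sup>2\<close>, its orthogonal
  complement contains all negative powers of \<open>z\<close>. These form an orthonormal sequence, which tends
  weakly to zero by Bessel's inequality, so a compact \<open>D\<close> satisfies \<open>\<parallel>D z\<^sup>-\<^sup>n\<parallel> \<rightarrow> 0\<close> along a subsequence.
  On the other hand, for every integer \<open>k\<close> and every \<open>n > k\<close> with \<open>n \<ge> 1\<close>, both \<open>z\<^sup>-\<^sup>n\<close> and \<open>z\<^sup>k\<^sup>-\<^sup>n\<close> lie in
  the complement of \<open>M\<close>, whence

    \<open>\<langle>D z\<^sup>-\<^sup>n, z\<^sup>k\<^sup>-\<^sup>n\<rangle> = \<langle>\<phi> z\<^sup>-\<^sup>n, z\<^sup>k\<^sup>-\<^sup>n\<rangle> = \<langle>\<phi>, z\<^sup>k\<rangle>\<close>,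

  so the \<open>k\<close>-th Fourier coefficient of \<open>\<phi>\<close> is bounded by \<open>\<parallel>D z\<^sup>-\<^sup>n\<parallel>\<close> and must vanish. A function all of
  whose Fourier coefficients vanish is zero almost everywhere. This is
  \<open>compact_dual_toeplitz_imp_zero\<close>. Conversely, for \<open>\<phi> = 0\<close> the operator vanishes.

  Two facts of analysis carry the argument. The first is that the orthogonal projection exists
  (\<open>orth_proj_ominus\<close>), which rests on the completeness of \<open>L\<^sup>2\<close> (\<open>L2_complete\<close>). The second is the
  uniqueness theorem for Fourier coefficients (\<open>Fourier_uniqueness\<close>): by Stone--Weierstrass the
  function integrates to zero against continuous functions, then over closed sets, then over Borel
  sets.
\<close>


section \<open>Normalized arc length on the circle\<close>

lemma space_circle_measure [simp]: "space circle_measure = sphere 0 1"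
  by (simp add: circle_measure_def space_restrict_space)

lemma sets_circle_measure [measurable_cong]:
  "sets circle_measure = sets (restrict_space borel (sphere 0 1))"
  by (simp add: circle_measure_def)

lemma borel_imp_measurable_circle:
  "f \<in> borel_measurable borel \<Longrightarrow> f \<in> borel_measurable circle_measure"
  by (simp add: measurable_cong_sets[OF sets_circle_measure refl] measurable_restrict_space1)

lemma measurable_cis [measurable]: "cis \<in> borel_measurable borel"
  by (intro borel_measurable_continuous_onI continuous_intros)

lemma measurable_cis_circle [measurable]:
  "cis \<in> borel \<rightarrow>\<^sub>M restrict_space borel (sphere 0 1)"
  by (intro measurable_restrict_space2 borel_measurable_continuous_onI continuous_intros) auto

lemma measurable_cis_uniform [measurable]:
  "cis \<in> uniform_measure lborel {0..2*pi} \<rightarrow>\<^sub>M restrict_space borel (sphere 0 1)"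
  using measurable_cis_circle by (simp add: measurable_def)

interpretation circle: prob_space circle_measure
proof -
  interpret U: prob_space "uniform_measure lborel {0..2*pi}"
    by (rule prob_space_uniform_measure) auto
  show "prob_space circle_measure"
    unfolding circle_measure_def by (rule U.prob_space_distr) simp
qed

lemma measurable_powi_circle [measurable]:
  "(\<lambda>z. z powi k) \<in> borel_measurable circle_measure"
  by (rule borel_imp_measurable_circle) (cases "k \<ge> 0"; simp add: power_int_def)

lemma integral_powi_circle:
  assumes "k \<noteq> 0"
  shows "(LINT z|circle_measure. z powi k) = 0"
proof -
  let ?U = "uniform_measure lborel {0..2*pi}"
  have "(LINT z|circle_measure. z powi k) = (LINT t|?U. cis t powi k)"
    unfolding circle_measure_def
    by (rule integral_distr) (use measurable_powi_circle in \<open>simp_all add: measurable_cong_sets[OF sets_circle_measure refl]\<close>)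
  also have "\<dots> = (LINT t|?U. cis (of_int k * t))"
    by (simp add: cis_power_int)
  also have "\<dots> = (LINT t|lborel. (indicator {0..2*pi} t / (2*pi)) *\<^sub>R cis (of_int k * t))"
  proof -
    have "?U = density lborel (\<lambda>t. ennreal (indicator {0..2*pi} t / (2*pi)))"
      unfolding uniform_measure_def
      by (rule density_cong)
        (auto simp: indicator_def divide_ennreal[symmetric] ennreal_mult)
    then show ?thesis
      by (simp only:) (subst integral_density; simp)
  qed
  also have "\<dots> = (1/(2*pi)) *\<^sub>R (LINT t|lborel. indicator {0..2*pi} t *\<^sub>R cis (of_int k * t))"
    by (subst integral_scaleR_right[symmetric]) (simp_all add: field_simps)
  also have "(LINT t|lborel. indicator {0..2*pi} t *\<^sub>R cis (of_int k * t)) =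
      cis (of_int k * (2*pi)) / (\<i> * of_int k) - cis (of_int k * 0) / (\<i> * of_int k)"
  proof (rule integral_FTC_Icc)
    fix t :: real
    have "((\<lambda>t. exp (\<i> * of_int k * of_real t) / (\<i> * of_int k)) has_vector_derivative
        exp (\<i> * of_int k * of_real t)) (at t within {0..2*pi})"
      by (rule derivative_eq_intros refl has_vector_derivative_real_field | simp add: assms)+
    then show "((\<lambda>t. cis (of_int k * t) / (\<i> * of_int k)) has_vector_derivative
        cis (of_int k * t)) (at t within {0..2*pi})"
      by (simp add: cis_conv_exp mult.assoc)
  qed (auto intro!: continuous_intros)
  also have "cis (of_int k * (2*pi)) = 1"
    using cis_multiple_2pi[of "of_int k"] by (simp add: mult_ac)
  finally show ?thesis by simp
qed

section \<open>The space of square integrable functions\<close>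

lemma L2D:
  assumes "f \<in> L2"
  shows "f \<in> borel_measurable circle_measure" "integrable circle_measure (\<lambda>z. (norm (f z))\<^sup>2)"
  using assms by (auto simp: L2_def)

lemma L2_norm_nonneg [simp]: "0 \<le> L2_norm f"
  by (simp add: L2_norm_def)

lemma L2_norm_sq: "(L2_norm f)\<^sup>2 = (LINT z|circle_measure. (norm (f z))\<^sup>2)"
  by (simp add: L2_norm_def)

lemma L2_inner_self: "L2_inner f f = of_real ((L2_norm f)\<^sup>2)"
  unfolding L2_inner_def L2_norm_sq integral_complex_of_real[symmetric]
  by (simp only: complex_norm_square)

lemma L2_inner_commute: "L2_inner g f = cnj (L2_inner f g)"
  using Bochner_Integration.integral_cnj[of circle_measure "\<lambda>z. f z * cnj (g z)"]
  by (simp add: L2_inner_def mult.commute)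

lemma L2_zero: "(\<lambda>z. 0) \<in> L2"
  by (simp add: L2_def)

lemma L2_scale: "f \<in> L2 \<Longrightarrow> (\<lambda>z. c * f z) \<in> L2"
  by (auto simp: L2_def norm_mult power_mult_distrib)

lemma L2_add:
  assumes "f \<in> L2" "g \<in> L2"
  shows "(\<lambda>z. f z + g z) \<in> L2"
proof -
  note [measurable] = L2D(1)[OF assms(1)] L2D(1)[OF assms(2)]
  have "integrable circle_measure (\<lambda>z. (norm (f z + g z))\<^sup>2)"
  proof (rule Bochner_Integration.integrable_bound)
    show "integrable circle_measure (\<lambda>z. 2 * (norm (f z))\<^sup>2 + 2 * (norm (g z))\<^sup>2)"
      using L2D(2)[OF assms(1)] L2D(2)[OF assms(2)] by simp
    have "(norm (a + b))\<^sup>2 \<le> 2 * (norm a)\<^sup>2 + 2 * (norm b)\<^sup>2" for a b :: complex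
    proof -
      have "(norm (a + b))\<^sup>2 \<le> (norm a + norm b)\<^sup>2"
        by (intro power_mono norm_triangle_ineq) simp
      also have "\<dots> \<le> 2 * (norm a)\<^sup>2 + 2 * (norm b)\<^sup>2"
        using sum_squares_bound[of "norm a" "norm b"] by (simp add: power2_sum)
      finally show ?thesis .
    qed
    then show "AE z in circle_measure. norm ((norm (f z + g z))\<^sup>2)
        \<le> norm (2 * (norm (f z))\<^sup>2 + 2 * (norm (g z))\<^sup>2)"
      by auto
  qed simp
  then show ?thesis by (simp add: L2_def)
qed

lemma L2_diff:
  assumes "f \<in> L2" "g \<in> L2"
  shows "(\<lambda>z. f z - g z) \<in> L2"
  using L2_add[OF assms(1) L2_scale[OF assms(2), of "-1"]] by simp

lemma L2_mult_Linfty: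
  assumes "\<phi> \<in> Linfty" "f \<in> L2"
  shows "(\<lambda>z. \<phi> z * f z) \<in> L2"
proof -
  obtain C where C: "AE z in circle_measure. norm (\<phi> z) \<le> C"
    and [measurable]: "\<phi> \<in> borel_measurable circle_measure"
    using assms(1) by (auto simp: Linfty_def)
  note [measurable] = L2D(1)[OF assms(2)]
  have "integrable circle_measure (\<lambda>z. (norm (\<phi> z * f z))\<^sup>2)"
  proof (rule Bochner_Integration.integrable_bound)
    show "integrable circle_measure (\<lambda>z. C\<^sup>2 * (norm (f z))\<^sup>2)"
      using L2D(2)[OF assms(2)] by simp
    show "AE z in circle_measure. norm ((norm (\<phi> z * f z))\<^sup>2) \<le> norm (C\<^sup>2 * (norm (f z))\<^sup>2)"
      using C by eventually_elim (auto simp: norm_mult power_mult_distrib intro!: mult_right_mono power_mono)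
  qed simp
  then show ?thesis by (simp add: L2_def)
qed

lemma L2_integrable_mult:
  assumes "f \<in> L2" "g \<in> L2"
  shows "integrable circle_measure (\<lambda>z. f z * g z)"
proof -
  note [measurable] = L2D(1)[OF assms(1)] L2D(1)[OF assms(2)]
  show ?thesis
  proof (rule Bochner_Integration.integrable_bound)
    show "integrable circle_measure (\<lambda>z. (norm (f z))\<^sup>2 + (norm (g z))\<^sup>2)"
      using L2D(2)[OF assms(1)] L2D(2)[OF assms(2)] by simp
    have "norm a * norm b \<le> (norm a)\<^sup>2 + (norm b)\<^sup>2" for a b :: complex
    proof -
      have "0 \<le> norm a * norm b" by simp
      then show ?thesis using sum_squares_bound[of "norm a" "norm b"] by linarith
    qed
    then show "AE z in circle_measure. norm (f z * g z) \<le> norm ((norm (f z))\<^sup>2 + (norm (g z))\<^sup>2)"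
      by (auto simp: norm_mult)
  qed simp
qed

lemma measurable_cnj [measurable]: "cnj \<in> borel_measurable borel"
  by (intro borel_measurable_continuous_onI continuous_intros)

lemma L2_cnj: "f \<in> L2 \<Longrightarrow> (\<lambda>z. cnj (f z)) \<in> L2"
  by (auto simp: L2_def)

lemma L2_inner_diff_left:
  assumes "f \<in> L2" "g \<in> L2" "k \<in> L2"
  shows "L2_inner (\<lambda>z. f z - g z) k = L2_inner f k - L2_inner g k"
  using L2_integrable_mult[OF assms(1) L2_cnj[OF assms(3)]] L2_integrable_mult[OF assms(2) L2_cnj[OF assms(3)]]
  by (simp add: L2_inner_def left_diff_distrib)

lemma L2_inner_scale_left: "L2_inner (\<lambda>z. c * f z) k = c * L2_inner f k"
  by (simp add: L2_inner_def mult.assoc)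

text \<open>The Cauchy--Schwarz and triangle inequalities, the parallelogram law and Bessel's inequality
  are all read off from this expansion by choosing \<open>c\<close>.\<close>

lemma L2_norm_diff_sq:
  assumes "f \<in> L2" "g \<in> L2"
  shows "(L2_norm (\<lambda>z. f z - c * g z))\<^sup>2 =
    (L2_norm f)\<^sup>2 - 2 * Re (cnj c * L2_inner f g) + (norm c)\<^sup>2 * (L2_norm g)\<^sup>2"
proof -
  have *: "(norm (a - c * b))\<^sup>2 = (norm a)\<^sup>2 - 2 * Re (cnj c * (a * cnj b)) + (norm c)\<^sup>2 * (norm b)\<^sup>2"
    for a b :: complex
    by (simp only: cmod_power2) (simp add: power2_eq_square algebra_simps)
  have int: "integrable circle_measure (\<lambda>z. cnj c * (f z * cnj (g z)))"
    using L2_integrable_mult[OF assms(1) L2_cnj[OF assms(2)]] by simp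
  then have "(LINT z|circle_measure. Re (cnj c * (f z * cnj (g z)))) = Re (cnj c * L2_inner f g)"
    by (subst integral_Re) (simp_all add: L2_inner_def)
  then show ?thesis
    unfolding L2_norm_sq *
    using L2D(2)[OF assms(1)] L2D(2)[OF assms(2)] integrable_Re[OF int]
    by (simp del: times_complex.sel)
qed

text \<open>If subtracting multiples of \<open>g\<close> lowers \<open>\<parallel>f\<parallel>\<^sup>2\<close> by at most \<open>e\<close>, then \<open>f\<close> is almost
  orthogonal to \<open>g\<close>: the best multiple lowers it by exactly \<open>\<bar>\<langle>f,g\<rangle>\<bar>\<^sup>2 / \<parallel>g\<parallel>\<^sup>2\<close>. For
  \<open>e = \<parallel>f\<parallel>\<^sup>2\<close> the assumption is void and this is the Cauchy--Schwarz inequality; for \<open>f = w - k\<close> with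
  \<open>k\<close> a nearly best approximation to \<open>w\<close> in a subspace it gives the orthogonality relation of the
  projection theorem.\<close>

lemma L2_inner_le_of_almost_minimal:
  assumes "f \<in> L2" "g \<in> L2"
    and almost_min: "\<And>c. (L2_norm f)\<^sup>2 - e \<le> (L2_norm (\<lambda>z. f z - c * g z))\<^sup>2"
  shows "(norm (L2_inner f g))\<^sup>2 \<le> e * (L2_norm g)\<^sup>2"
proof -
  let ?a = "L2_inner f g"
  have *: "2 * t * (norm ?a)\<^sup>2 \<le> e + t\<^sup>2 * (norm ?a)\<^sup>2 * (L2_norm g)\<^sup>2" for t :: real
  proof -
    have "Re (cnj (of_real t * ?a) * ?a) = t * (norm ?a)\<^sup>2"
      by (simp only: cmod_power2) (simp add: power2_eq_square algebra_simps)
    then show ?thesis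
      using almost_min[of "of_real t * ?a"]
      by (simp add: L2_norm_diff_sq[OF assms(1,2)] norm_mult power_mult_distrib)
  qed
  show ?thesis
  proof (cases "L2_norm g = 0")
    case False
    define G where "G = (L2_norm g)\<^sup>2"
    have "G > 0" using False by (simp add: G_def)
    then have "2 * (norm ?a)\<^sup>2 / G \<le> e + (norm ?a)\<^sup>2 / G"
      using *[of "1 / G"] unfolding G_def[symmetric] by (simp add: power2_eq_square)
    then have "(norm ?a)\<^sup>2 / G \<le> e" by simp
    then show ?thesis
      unfolding G_def[symmetric] using \<open>G > 0\<close> by (simp add: pos_divide_le_eq)
  next
    case True
    show ?thesis
    proof (rule ccontr)
      \<comment> \<open>Now the quadratic term in \<open>t\<close> vanishes, so \<open>2 t \<bar>\<langle>f,g\<rangle>\<bar>\<^sup>2 \<le> e\<close> for all \<open>t\<close>; the chosen \<open>t\<close>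
        makes the left side \<open>e + 1\<close>.\<close>
      assume "\<not> ?thesis"
      then have "?a \<noteq> 0" using True by auto
      then show False
        using *[of "(e + 1) / (2 * (norm ?a)\<^sup>2)"] True by simp
    qed
  qed
qed

lemma L2_Cauchy_Schwarz:
  assumes "f \<in> L2" "g \<in> L2"
  shows "norm (L2_inner f g) \<le> L2_norm f * L2_norm g"
proof -
  have "(norm (L2_inner f g))\<^sup>2 \<le> (L2_norm f * L2_norm g)\<^sup>2"
    unfolding power_mult_distrib
    by (rule L2_inner_le_of_almost_minimal[OF assms]) simp
  then show ?thesis by (rule power2_le_imp_le) simp
qed

lemma L2_norm_add_le:
  assumes "f \<in> L2" "g \<in> L2"
  shows "L2_norm (\<lambda>z. f z + g z) \<le> L2_norm f + L2_norm g"
proof (rule power2_le_imp_le)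
  have "(L2_norm (\<lambda>z. f z + g z))\<^sup>2 = (L2_norm f)\<^sup>2 + 2 * Re (L2_inner f g) + (L2_norm g)\<^sup>2"
    using L2_norm_diff_sq[OF assms, of "-1"] by simp
  moreover have "Re (L2_inner f g) \<le> L2_norm f * L2_norm g"
    using complex_Re_le_cmod L2_Cauchy_Schwarz[OF assms] order_trans by blast
  ultimately show "(L2_norm (\<lambda>z. f z + g z))\<^sup>2 \<le> (L2_norm f + L2_norm g)\<^sup>2"
    by (simp add: power2_sum)
qed simp

lemma L2_norm_scale: "L2_norm (\<lambda>z. c * f z) = norm c * L2_norm f"
  by (simp add: L2_norm_def norm_mult power_mult_distrib real_sqrt_mult)

lemma L2_parallelogram:
  assumes "f \<in> L2" "g \<in> L2"
  shows "(L2_norm (\<lambda>z. f z - g z))\<^sup>2 + (L2_norm (\<lambda>z. f z + g z))\<^sup>2 =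
    2 * (L2_norm f)\<^sup>2 + 2 * (L2_norm g)\<^sup>2"
  using L2_norm_diff_sq[OF assms, of 1] L2_norm_diff_sq[OF assms, of "-1"] by simp

lemma powi_L2: "(\<lambda>z. z powi k) \<in> L2"
proof -
  have "integrable circle_measure (\<lambda>z. (norm (z powi k))\<^sup>2)"
  proof (rule circle.integrable_const_bound[of _ 1])
    show "AE z in circle_measure. norm ((norm (z powi k))\<^sup>2) \<le> 1"
      by (rule AE_I2) (simp add: norm_power_int)
  qed measurable
  then show ?thesis by (simp add: L2_def)
qed

lemma cnj_powi_circle:
  assumes "norm z = 1"
  shows "cnj (z powi k) = z powi (- k)"
proof -
  have "cnj z = inverse z"
    using assms by (simp add: inverse_complex_def complex_eq_iff cmod_def)
  then show ?thesis by (simp add: power_int_minus power_int_inverse)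
qed

lemma L2_inner_powi:
  "L2_inner (\<lambda>z. z powi j) (\<lambda>z. z powi k) = (if j = k then 1 else 0)"
proof -
  have "L2_inner (\<lambda>z. z powi j) (\<lambda>z. z powi k) = (LINT z|circle_measure. z powi (j - k))"
    unfolding L2_inner_def
  proof (rule Bochner_Integration.integral_cong[OF refl])
    fix z assume "z \<in> space circle_measure"
    then have z: "norm z = 1" "z \<noteq> 0" by auto
    show "z powi j * cnj (z powi k) = z powi (j - k)"
      unfolding cnj_powi_circle[OF z(1)] using z(2)
      by (simp add: power_int_diff power_int_minus divide_inverse)
  qed
  then show ?thesis
    using integral_powi_circle[of "j - k"] circle.prob_space by auto
qed

lemma L2_norm_powi: "L2_norm (\<lambda>z. z powi k) = 1"
proof -
  have "complex_of_real ((L2_norm (\<lambda>z. z powi k))\<^sup>2) = of_real 1"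
    using L2_inner_self[of "\<lambda>z. z powi k"] L2_inner_powi[of k k] by simp
  then have "(L2_norm (\<lambda>z. z powi k))\<^sup>2 = 1"
    by (simp only: of_real_eq_iff)
  then show ?thesis
    using L2_norm_nonneg[of "\<lambda>z. z powi k"] by (auto simp: power2_eq_1_iff)
qed

section \<open>Completeness and orthogonal projection\<close>

lemma integral_norm_le_L2_norm:
  assumes "f \<in> L2"
  shows "integrable circle_measure (\<lambda>z. norm (f z))"
    and "(LINT z|circle_measure. norm (f z)) \<le> L2_norm f"
proof -
  note [measurable] = L2D(1)[OF assms]
  have one: "(\<lambda>z. 1) \<in> L2" "L2_norm (\<lambda>z. 1) = 1"
    using powi_L2[of 0] L2_norm_powi[of 0] by simp_all
  have mod: "(\<lambda>z. of_real (norm (f z))) \<in> L2" "L2_norm (\<lambda>z. of_real (norm (f z))) = L2_norm f"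
    using L2D(2)[OF assms] by (auto simp: L2_def L2_norm_def)
  show "integrable circle_measure (\<lambda>z. norm (f z))"
    using integrable_norm[OF L2_integrable_mult[OF mod(1) one(1)]] by simp
  show "(LINT z|circle_measure. norm (f z)) \<le> L2_norm f"
    using L2_Cauchy_Schwarz[OF mod(1) one(1)] by (simp add: L2_inner_def mod(2) one(2))
qed

text \<open>The measure is a probability, so \<open>L\<^sup>2\<close> norms dominate \<open>L\<^sup>1\<close> norms, and by monotone
  convergence the sum of the \<open>\<bar>G n\<bar>\<close> has finite integral.\<close>

lemma AE_summable_norm:
  assumes "\<And>n. G n \<in> L2" "\<And>n. L2_norm (G n) \<le> b n" "summable b"
  shows "AE z in circle_measure. summable (\<lambda>n::nat. norm (G n z))"
proof -
  note [measurable] = L2D(1)[OF assms(1)]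
  have "(\<integral>\<^sup>+ z. (\<Sum>n. ennreal (norm (G n z))) \<partial>circle_measure) =
      (\<Sum>n. \<integral>\<^sup>+ z. ennreal (norm (G n z)) \<partial>circle_measure)"
    by (rule nn_integral_suminf) measurable
  also have "\<dots> \<le> (\<Sum>n. ennreal (b n))"
  proof (rule suminf_le)
    fix n
    have "(\<integral>\<^sup>+ z. ennreal (norm (G n z)) \<partial>circle_measure) = ennreal (LINT z|circle_measure. norm (G n z))"
      by (rule nn_integral_eq_integral) (simp_all add: integral_norm_le_L2_norm assms(1))
    also have "\<dots> \<le> ennreal (b n)"
      using integral_norm_le_L2_norm(2)[OF assms(1)[of n]] assms(2)[of n] by (intro ennreal_leI) linarith
    finally show "(\<integral>\<^sup>+ z. ennreal (norm (G n z)) \<partial>circle_measure) \<le> ennreal (b n)" .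
  qed auto
  also have "\<dots> < \<infinity>"
  proof -
    have "0 \<le> b n" for n
      using assms(2)[of n] L2_norm_nonneg[of "G n"] by linarith
    then have "(\<Sum>n. ennreal (b n)) = ennreal (suminf b)"
      using assms(3) by (intro suminf_ennreal2) auto
    then show ?thesis by simp
  qed
  finally have "(\<integral>\<^sup>+ z. (\<Sum>n. ennreal (norm (G n z))) \<partial>circle_measure) \<noteq> \<infinity>" by simp
  then have "AE z in circle_measure. (\<Sum>n. ennreal (norm (G n z))) \<noteq> \<infinity>"
    by (intro nn_integral_noteq_infinite) measurable
  then show ?thesis
    by eventually_elim (auto intro!: summable_suminf_not_top)
qed

lemma L2_norm_diff_le_suminf:
  assumes F: "\<And>n. F n \<in> L2" and b: "\<And>n. L2_norm (\<lambda>z. F (Suc n) z - F n z) \<le> b n"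
    and sum: "summable b"
  shows "L2_norm (\<lambda>z. F (n + j) z - F n z) \<le> (\<Sum>i. b (i + n))"
proof -
  have "L2_norm (\<lambda>z. F (n + j) z - F n z) \<le> (\<Sum>i<j. b (i + n))"
  proof (induction j)
    case 0
    then show ?case by (simp add: L2_norm_def)
  next
    case (Suc j)
    have "L2_norm (\<lambda>z. F (n + Suc j) z - F n z) =
        L2_norm (\<lambda>z. (F (n + Suc j) z - F (n + j) z) + (F (n + j) z - F n z))"
      by simp
    also have "\<dots> \<le> L2_norm (\<lambda>z. F (n + Suc j) z - F (n + j) z) + L2_norm (\<lambda>z. F (n + j) z - F n z)"
      by (rule L2_norm_add_le[OF L2_diff[OF F F] L2_diff[OF F F]])
    also have "\<dots> \<le> b (n + j) + (\<Sum>i<j. b (i + n))"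
      using b[of "n + j"] Suc.IH by (intro add_mono) simp_all
    finally show ?case by (simp add: add.commute)
  qed
  also have "\<dots> \<le> (\<Sum>i. b (i + n))"
  proof (rule sum_le_suminf)
    show "summable (\<lambda>i. b (i + n))" using sum by (simp add: summable_iff_shift)
    show "0 \<le> b (i + n)" for i using b[of "i+n"] L2_norm_nonneg order_trans by blast
  qed simp
  finally show ?thesis .
qed

text \<open>The Riesz--Fischer theorem, for sequences with summable increments: the increments are
  absolutely summable at almost every point, which produces a pointwise limit, and Fatou's lemma
  turns the bound on \<open>\<parallel>F (n + j) - F n\<parallel>\<close> into the same bound on \<open>\<parallel>g - F n\<parallel>\<close>.\<close>

lemma L2_complete:
  assumes F: "\<And>n. F n \<in> L2" and b: "\<And>n. L2_norm (\<lambda>z. F (Suc n) z - F n z) \<le> b n"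
    and sum: "summable b"
  obtains g where "g \<in> L2" "(\<lambda>n. L2_norm (\<lambda>z. F n z - g z)) \<longlonglongrightarrow> 0"
proof -
  note [measurable] = L2D(1)[OF F]
  define g where "g = (\<lambda>z. lim (\<lambda>n. F n z))"
  have [measurable]: "g \<in> borel_measurable circle_measure"
    unfolding g_def by measurable
  have "AE z in circle_measure. summable (\<lambda>n. norm (F (Suc n) z - F n z))"
    by (rule AE_summable_norm[OF L2_diff[OF F F] b sum])
  then have lim: "AE z in circle_measure. (\<lambda>n. F n z) \<longlonglongrightarrow> g z"
  proof eventually_elim
    case (elim z)
    then have "summable (\<lambda>n. F (Suc n) z - F n z)" by (rule summable_norm_cancel)
    then have "convergent (\<lambda>n. \<Sum>i<n. F (Suc i) z - F i z)"
      by (simp add: summable_iff_convergent)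
    then have "convergent (\<lambda>n. F n z - F 0 z)"
      by (simp only: sum_lessThan_telescope[of "\<lambda>i. F i z"])
    then have "convergent (\<lambda>n. (F n z - F 0 z) + F 0 z)"
      by (intro convergent_add convergent_const)
    then show ?case by (simp add: g_def convergent_LIMSEQ_iff)
  qed
  define R where "R n = (\<Sum>i. b (i + n))" for n
  have R0: "0 \<le> R n" for n
    using L2_norm_diff_le_suminf[OF F b sum, of n 0] L2_norm_nonneg order_trans unfolding R_def by blast
  have fatou: "(\<integral>\<^sup>+ z. ennreal ((norm (F n z - g z))\<^sup>2) \<partial>circle_measure) \<le> ennreal ((R n)\<^sup>2)" for n
  proof -
    have "(\<integral>\<^sup>+ z. ennreal ((norm (F n z - g z))\<^sup>2) \<partial>circle_measure) =
        (\<integral>\<^sup>+ z. liminf (\<lambda>j. ennreal ((norm (F (n + j) z - F n z))\<^sup>2)) \<partial>circle_measure)"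
    proof (rule nn_integral_cong_AE, use lim in eventually_elim)
      case (elim z)
      have "(\<lambda>j. F (n + j) z) \<longlonglongrightarrow> g z"
        using LIMSEQ_ignore_initial_segment[OF elim, of n] by (simp add: add.commute)
      then have "(\<lambda>j. ennreal ((norm (F (n + j) z - F n z))\<^sup>2)) \<longlonglongrightarrow> ennreal ((norm (g z - F n z))\<^sup>2)"
        by (intro tendsto_intros)
      from lim_imp_Liminf[OF _ this] show ?case by (simp add: norm_minus_commute)
    qed
    also have "\<dots> \<le> liminf (\<lambda>j. \<integral>\<^sup>+ z. ennreal ((norm (F (n + j) z - F n z))\<^sup>2) \<partial>circle_measure)"
      by (rule nn_integral_liminf) measurable
    also have "\<dots> \<le> liminf (\<lambda>j. ennreal ((R n)\<^sup>2))"
    proof (rule Liminf_mono, rule always_eventually, rule allI)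
      fix j
      have "(\<integral>\<^sup>+ z. ennreal ((norm (F (n + j) z - F n z))\<^sup>2) \<partial>circle_measure)
          = ennreal ((L2_norm (\<lambda>z. F (n + j) z - F n z))\<^sup>2)"
        unfolding L2_norm_sq
        by (rule nn_integral_eq_integral) (simp_all add: L2D(2)[OF L2_diff[OF F F]])
      also have "\<dots> \<le> ennreal ((R n)\<^sup>2)"
        using L2_norm_diff_le_suminf[OF F b sum, of n j]
        by (intro ennreal_leI power_mono) (simp_all add: R_def)
      finally show "(\<integral>\<^sup>+ z. ennreal ((norm (F (n + j) z - F n z))\<^sup>2) \<partial>circle_measure) \<le> ennreal ((R n)\<^sup>2)" .
    qed
    also have "\<dots> = ennreal ((R n)\<^sup>2)" by (simp add: Liminf_const)
    finally show ?thesis .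
  qed
  have int: "integrable circle_measure (\<lambda>z. (norm (F n z - g z))\<^sup>2)" for n
  proof (rule integrableI_bounded)
    show "(\<integral>\<^sup>+ z. ennreal (norm ((norm (F n z - g z))\<^sup>2)) \<partial>circle_measure) < \<infinity>"
      using fatou[of n] by (simp add: le_less_trans[OF _ ennreal_less_top])
  qed measurable
  then have diff: "(\<lambda>z. F n z - g z) \<in> L2" for n
    by (simp add: L2_def)
  have "g \<in> L2"
    using L2_diff[OF F diff, of 0 0] by simp
  moreover have "(\<lambda>n. L2_norm (\<lambda>z. F n z - g z)) \<longlonglongrightarrow> 0"
  proof (rule tendsto_sandwich[OF _ _ tendsto_const])
    have "ennreal ((L2_norm (\<lambda>z. F n z - g z))\<^sup>2) \<le> ennreal ((R n)\<^sup>2)" for n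
      using fatou[of n] unfolding L2_norm_sq
      by (subst (asm) nn_integral_eq_integral[OF int]) simp_all
    then have "L2_norm (\<lambda>z. F n z - g z) \<le> R n" for n
      by (intro power2_le_imp_le[OF _ R0]) (simp add: ennreal_le_iff)
    then show "\<forall>\<^sub>F n in sequentially. L2_norm (\<lambda>z. F n z - g z) \<le> R n" by simp
    show "R \<longlonglongrightarrow> 0"
      unfolding R_def using suminf_exist_split2[OF sum] by simp
  qed simp
  ultimately show ?thesis by (rule that)
qed

lemma L2_inner_tendsto_left:
  assumes "\<And>n. F n \<in> L2" "g \<in> L2" "k \<in> L2" "(\<lambda>n. L2_norm (\<lambda>z. F n z - g z)) \<longlonglongrightarrow> 0"
  shows "(\<lambda>n. L2_inner (F n) k) \<longlonglongrightarrow> L2_inner g k"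
proof -
  have "(\<lambda>n. L2_inner (F n) k - L2_inner g k) \<longlonglongrightarrow> 0"
  proof (rule Lim_null_comparison)
    show "\<forall>\<^sub>F n in sequentially. norm (L2_inner (F n) k - L2_inner g k)
        \<le> L2_norm (\<lambda>z. F n z - g z) * L2_norm k"
      using L2_Cauchy_Schwarz[OF L2_diff[OF assms(1,2)] assms(3)]
      by (simp add: L2_inner_diff_left assms)
    show "(\<lambda>n. L2_norm (\<lambda>z. F n z - g z) * L2_norm k) \<longlonglongrightarrow> 0"
      using tendsto_mult_left_zero[OF assms(4)] .
  qed
  then show ?thesis by (simp add: LIM_zero_iff)
qed

text \<open>The projection theorem. By the parallelogram law, elements of \<open>M\<close> whose squared distance
  to \<open>f\<close> exceeds the infimum by at most \<open>4\<^sup>-\<^sup>n\<close> have increments of size \<open>O(2\<^sup>-\<^sup>n)\<close>, so they converge, and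
  the limit inherits the orthogonality relation that they satisfy approximately.\<close>

lemma projection_exists:
  assumes M: "L2_subspace M" "L2_closed M" and f: "f \<in> L2"
  obtains p where "p \<in> M" "\<And>k. k \<in> M \<Longrightarrow> L2_inner (\<lambda>z. f z - p z) k = 0"
proof -
  have ML2: "k \<in> L2" if "k \<in> M" for k using M(1) that by (auto simp: L2_subspace_def)
  have M0: "(\<lambda>z. 0) \<in> M" using M(1) by (simp add: L2_subspace_def)
  have Madd: "(\<lambda>z. k z + c * l z) \<in> M" if "k \<in> M" "l \<in> M" for k l c
  proof -
    have "(\<lambda>z. c * l z) \<in> M" using M(1) that(2) by (simp add: L2_subspace_def)
    then show ?thesis using M(1) that(1) by (simp add: L2_subspace_def)
  qed
  define d where "d = (INF k\<in>M. (L2_norm (\<lambda>z. f z - k z))\<^sup>2)"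
  have bdd: "bdd_below ((\<lambda>k. (L2_norm (\<lambda>z. f z - k z))\<^sup>2) ` M)"
    by (rule bdd_belowI[of _ 0]) auto
  have d_le: "d \<le> (L2_norm (\<lambda>z. f z - k z))\<^sup>2" if "k \<in> M" for k
    unfolding d_def by (rule cINF_lower[OF bdd that])
  have "\<exists>k\<in>M. (L2_norm (\<lambda>z. f z - k z))\<^sup>2 < d + (1/4) ^ n" for n
    using cINF_less_iff[OF _ bdd, of "d + (1/4)^n"] M0 unfolding d_def by auto
  then obtain K where K: "\<And>n. K n \<in> M" "\<And>n. (L2_norm (\<lambda>z. f z - K n z))\<^sup>2 < d + (1/4) ^ n"
    by metis
  have incr: "L2_norm (\<lambda>z. K (Suc n) z - K n z) \<le> 2 * (1/2) ^ n" for n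
  proof (rule power2_le_imp_le)
    let ?a = "\<lambda>z. f z - K n z" and ?b = "\<lambda>z. f z - K (Suc n) z"
    let ?m = "\<lambda>z. 1/2 * K n z + 1/2 * K (Suc n) z"
    have "?m \<in> M" using Madd[OF Madd[OF M0 K(1)[of n]] K(1)[of "Suc n"], of "1/2" "1/2"] by simp
    have "(\<lambda>z. ?a z + ?b z) = (\<lambda>z. 2 * (f z - ?m z))"
      by (rule ext) (simp add: algebra_simps)
    then have "(L2_norm (\<lambda>z. ?a z + ?b z))\<^sup>2 = 4 * (L2_norm (\<lambda>z. f z - ?m z))\<^sup>2"
      by (simp only: L2_norm_scale) simp
    also have "\<dots> \<ge> 4 * d" using d_le[OF \<open>?m \<in> M\<close>] by simp
    finally have mid: "4 * d \<le> (L2_norm (\<lambda>z. ?a z + ?b z))\<^sup>2" .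
    have "(L2_norm (\<lambda>z. K (Suc n) z - K n z))\<^sup>2 = (L2_norm (\<lambda>z. ?a z - ?b z))\<^sup>2" by simp
    also have "\<dots> \<le> 2 * (1/4) ^ n + 2 * (1/4) ^ Suc n"
      using L2_parallelogram[OF L2_diff[OF f ML2] L2_diff[OF f ML2], OF K(1)[of n] K(1)[of "Suc n"]]
        K(2)[of n] K(2)[of "Suc n"] mid by linarith
    also have "\<dots> \<le> 4 * (1/4) ^ n" by simp
    also have "\<dots> = (2 * (1/2) ^ n)\<^sup>2"
      unfolding power2_eq_square by (simp add: power_mult_distrib[symmetric] mult_ac)
    finally show "(L2_norm (\<lambda>z. K (Suc n) z - K n z))\<^sup>2 \<le> (2 * (1/2) ^ n)\<^sup>2" .
  qed simp
  have "summable (\<lambda>n. 2 * (1/2) ^ n :: real)"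
    by (intro summable_mult summable_geometric) simp
  then obtain p where p: "p \<in> L2" "(\<lambda>n. L2_norm (\<lambda>z. K n z - p z)) \<longlonglongrightarrow> 0"
    using L2_complete[of K "\<lambda>n. 2 * (1/2) ^ n", OF ML2[OF K(1)] incr] by blast
  then have "p \<in> M" using M(2) K(1) unfolding L2_closed_def by blast
  moreover have "L2_inner (\<lambda>z. f z - p z) k = 0" if "k \<in> M" for k
  proof -
    note kL2 = ML2[OF that]
    have bound: "(norm (L2_inner (\<lambda>z. f z - K n z) k))\<^sup>2 \<le> (1/4) ^ n * (L2_norm k)\<^sup>2" for n
    proof (rule L2_inner_le_of_almost_minimal[OF L2_diff[OF f ML2[OF K(1)]] kL2])
      fix c
      show "(L2_norm (\<lambda>z. f z - K n z))\<^sup>2 - (1/4) ^ n \<le> (L2_norm (\<lambda>z. f z - K n z - c * k z))\<^sup>2"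
        using d_le[OF Madd[OF K(1)[of n] that, of c]] K(2)[of n] by (simp add: diff_diff_eq)
    qed
    have "(\<lambda>n. L2_inner f k - L2_inner (K n) k) \<longlonglongrightarrow> L2_inner f k - L2_inner p k"
      by (intro tendsto_intros L2_inner_tendsto_left ML2 K p kL2)
    then have "(\<lambda>n. (norm (L2_inner (\<lambda>z. f z - K n z) k))\<^sup>2) \<longlonglongrightarrow> (norm (L2_inner (\<lambda>z. f z - p z) k))\<^sup>2"
      by (intro tendsto_intros) (simp add: L2_inner_diff_left f ML2 K(1) kL2 p(1))
    moreover have "(\<lambda>n. (1/4) ^ n * (L2_norm k)\<^sup>2) \<longlonglongrightarrow> 0"
      by (intro tendsto_mult_left_zero LIMSEQ_power_zero) simp
    ultimately have "(norm (L2_inner (\<lambda>z. f z - p z) k))\<^sup>2 \<le> 0"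
      using bound by (intro LIMSEQ_le[where X = "\<lambda>n. (norm (L2_inner (\<lambda>z. f z - K n z) k))\<^sup>2"]) auto
    then show ?thesis by simp
  qed
  ultimately show ?thesis by (rule that)
qed

text \<open>The choice in \<open>orth_proj\<close> is meaningful for the subspace \<open>L\<^sup>2 \<ominus> M\<close>: if \<open>p\<close> is the projection of
  \<open>f\<close> to the closed subspace \<open>M\<close>, then \<open>f - p\<close> is a projection of \<open>f\<close> to \<open>L\<^sup>2 \<ominus> M\<close>.\<close>

lemma orth_proj_ominus:
  assumes M: "L2_subspace M" "L2_closed M" and f: "f \<in> L2"
  shows "orth_proj (ominus L2 M) f \<in> ominus L2 M"
    and "k \<in> ominus L2 M \<Longrightarrow> L2_inner (orth_proj (ominus L2 M) f) k = L2_inner f k"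
proof -
  obtain p where p: "p \<in> M" "\<And>k. k \<in> M \<Longrightarrow> L2_inner (\<lambda>z. f z - p z) k = 0"
    using projection_exists[OF assms] by blast
  have pL2: "p \<in> L2" using M(1) p(1) by (auto simp: L2_subspace_def)
  have "(\<lambda>z. f z - p z) \<in> ominus L2 M"
    using p(2) L2_diff[OF f pL2] by (simp add: ominus_def)
  moreover have "L2_inner (\<lambda>z. f z - (f z - p z)) k = 0" if "k \<in> ominus L2 M" for k
    using that p(1) L2_inner_commute[of p k] by (simp add: ominus_def)
  ultimately have "\<exists>g. g \<in> ominus L2 M \<and> (\<forall>k\<in>ominus L2 M. L2_inner (\<lambda>z. f z - g z) k = 0)"
    by blast
  then have *: "orth_proj (ominus L2 M) f \<in> ominus L2 M \<and>
      (\<forall>k\<in>ominus L2 M. L2_inner (\<lambda>z. f z - orth_proj (ominus L2 M) f z) k = 0)"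
    unfolding orth_proj_def by (rule someI_ex)
  then show "orth_proj (ominus L2 M) f \<in> ominus L2 M" by blast
  show "L2_inner (orth_proj (ominus L2 M) f) k = L2_inner f k" if "k \<in> ominus L2 M"
    using * that L2_inner_diff_left[OF f, of "orth_proj (ominus L2 M) f" k] by (simp add: ominus_def)
qed

section \<open>Fourier coefficients\<close>

lemma Bessel_inequality:
  assumes "f \<in> L2" "inj e"
  shows "(\<Sum>n<N::nat. (norm (fourier_coeff f (e n)))\<^sup>2) \<le> (L2_norm f)\<^sup>2"
proof -
  have "\<exists>r\<in>L2. (L2_norm r)\<^sup>2 = (L2_norm f)\<^sup>2 - (\<Sum>n<N. (norm (fourier_coeff f (e n)))\<^sup>2) \<and>
      (\<forall>n\<ge>N. L2_inner r (\<lambda>z. z powi e n) = fourier_coeff f (e n))"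
  proof (induction N)
    case 0
    then show ?case using assms(1) by (auto simp: fourier_coeff_def)
  next
    case (Suc N)
    then obtain r where r: "r \<in> L2"
      "(L2_norm r)\<^sup>2 = (L2_norm f)\<^sup>2 - (\<Sum>n<N. (norm (fourier_coeff f (e n)))\<^sup>2)"
      "\<And>n. n \<ge> N \<Longrightarrow> L2_inner r (\<lambda>z. z powi e n) = fourier_coeff f (e n)" by blast
    let ?c = "fourier_coeff f (e N)"
    \<comment> \<open>\<open>r\<close> is \<open>f\<close> minus its components along the first \<open>N\<close> characters.\<close>
    let ?r = "\<lambda>z. r z - ?c * z powi e N"
    have "Re (cnj ?c * ?c) = (norm ?c)\<^sup>2"
      by (simp only: cmod_power2) (simp add: power2_eq_square)
    then have "(L2_norm ?r)\<^sup>2 = (L2_norm f)\<^sup>2 - (\<Sum>n<Suc N. (norm (fourier_coeff f (e n)))\<^sup>2)"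
      by (simp add: L2_norm_diff_sq[OF r(1) powi_L2] r(2,3) L2_norm_powi del: times_complex.sel)
    moreover have "L2_inner ?r (\<lambda>z. z powi e n) = fourier_coeff f (e n)" if "n \<ge> Suc N" for n
      using that assms(2) r(1,3)
      by (auto simp: L2_inner_diff_left L2_scale powi_L2 L2_inner_scale_left L2_inner_powi inj_eq)
    ultimately show ?case using L2_diff[OF r(1) L2_scale[OF powi_L2]] by blast
  qed
  then show ?thesis by (metis diff_ge_0_iff_ge zero_le_power2)
qed

text \<open>In other words, distinct characters tend weakly to zero; a compact operator turns this into
  norm convergence of their images.\<close>

lemma fourier_coeff_tendsto_0:
  assumes "f \<in> L2" "inj e"
  shows "(\<lambda>n::nat. fourier_coeff f (e n)) \<longlonglongrightarrow> 0"
proof -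
  have "summable (\<lambda>n. (norm (fourier_coeff f (e n)))\<^sup>2)"
    by (rule summableI_nonneg_bounded[OF _ Bessel_inequality[OF assms]]) simp
  then have "(\<lambda>n. (norm (fourier_coeff f (e n)))\<^sup>2) \<longlonglongrightarrow> 0" by (rule summable_LIMSEQ_zero)
  then have "(\<lambda>n. sqrt ((norm (fourier_coeff f (e n)))\<^sup>2)) \<longlonglongrightarrow> sqrt 0" by (intro tendsto_intros)
  then show ?thesis by (simp add: tendsto_norm_zero_iff)
qed

section \<open>Functions with vanishing Fourier coefficients\<close>

lemma integrable_mult_bounded:
  fixes f g :: "complex \<Rightarrow> complex"
  assumes "integrable circle_measure f" "g \<in> borel_measurable circle_measure"
    "\<And>z. norm z = 1 \<Longrightarrow> norm (g z) \<le> C"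
  shows "integrable circle_measure (\<lambda>z. f z * g z)"
proof (rule Bochner_Integration.integrable_bound)
  note [measurable] = borel_measurable_integrable[OF assms(1)] assms(2)
  show "integrable circle_measure (\<lambda>z. C * norm (f z))"
    using assms(1) by simp
  show "(\<lambda>z. f z * g z) \<in> borel_measurable circle_measure" by measurable
  show "AE z in circle_measure. norm (f z * g z) \<le> norm (C * norm (f z))"
  proof (rule AE_I2)
    fix z assume "z \<in> space circle_measure"
    then have "norm (g z) \<le> C" using assms(3) by simp
    then have "norm (f z) * norm (g z) \<le> norm (f z) * \<bar>C\<bar>" by (intro mult_left_mono) auto
    then show "norm (f z * g z) \<le> norm (C * norm (f z))"
      by (simp add: norm_mult abs_mult mult.commute)
  qed
qed

text \<open>The integrals are the Fourier coefficients of \<open>f\<close>. They are written with \<open>z\<^sup>k\<close> in place of its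
  conjugate \<open>z\<^sup>-\<^sup>k\<close>, which is harmless because \<open>k\<close> runs over all integers.\<close>

definition annihilates_trig :: "(complex \<Rightarrow> complex) \<Rightarrow> bool" where
  "annihilates_trig f \<longleftrightarrow> integrable circle_measure f \<and>
     (\<forall>k. (LINT z|circle_measure. f z * z powi k) = 0)"

lemma integrable_mult_powi:
  "integrable circle_measure f \<Longrightarrow> integrable circle_measure (\<lambda>z. f z * z powi k)"
  by (rule integrable_mult_bounded[where C = 1]) (auto simp: norm_power_int)

lemma annihilates_trig_add:
  assumes "annihilates_trig f" "annihilates_trig g"
  shows "annihilates_trig (\<lambda>z. f z + g z)"
  using assms integrable_mult_powi[of f] integrable_mult_powi[of g]
  by (simp add: annihilates_trig_def distrib_right)

lemma annihilates_trig_scale: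
  assumes "annihilates_trig f"
  shows "annihilates_trig (\<lambda>z. c * f z)"
  using assms by (simp add: annihilates_trig_def mult.assoc)

lemma annihilates_trig_mult_powi:
  assumes "annihilates_trig f"
  shows "annihilates_trig (\<lambda>z. f z * z powi j)"
proof -
  have "(LINT z|circle_measure. f z * z powi j * z powi k) = (LINT z|circle_measure. f z * z powi (j + k))" for k
  proof (rule Bochner_Integration.integral_cong[OF refl])
    fix z assume "z \<in> space circle_measure"
    then have "z \<noteq> 0" by auto
    then show "f z * z powi j * z powi k = f z * z powi (j + k)"
      by (simp add: power_int_add)
  qed
  then show ?thesis
    using assms integrable_mult_powi[of f] by (simp add: annihilates_trig_def)
qed

lemma annihilates_trig_cong:
  assumes "annihilates_trig f" "\<And>z. norm z = 1 \<Longrightarrow> f z = g z"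
  shows "annihilates_trig g"
proof -
  have "integrable circle_measure f \<longleftrightarrow> integrable circle_measure g"
    by (rule Bochner_Integration.integrable_cong) (simp_all add: assms(2))
  moreover have "(LINT z|circle_measure. f z * z powi k) = (LINT z|circle_measure. g z * z powi k)" for k
    by (rule Bochner_Integration.integral_cong) (simp_all add: assms(2))
  ultimately show ?thesis using assms(1) by (simp add: annihilates_trig_def)
qed

text \<open>Multiplication by a character only shifts the coefficients, so the class is a module over the
  characters. On the circle a real linear form \<open>l\<close> is a combination of \<open>z\<close> and \<open>z\<^sup>-\<^sup>1\<close>, hence the class
  is closed under multiplication by real polynomials in \<open>Re z\<close> and \<open>Im z\<close>. Inducting over the
  polynomial with \<open>f\<close> arbitrary makes the product case a composition, without expanding products of
  trigonometric sums.\<close>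

lemma annihilates_trig_mult_polynomial:
  assumes "real_polynomial_function p" "annihilates_trig f"
  shows "annihilates_trig (\<lambda>z. of_real (p z) * f z)"
  using assms
proof (induction p arbitrary: f rule: real_polynomial_function.induct)
  case (linear l)
  \<comment> \<open>The coefficients for which \<open>l z = a z + b z\<^sup>-\<^sup>1\<close> on the circle, where \<open>z\<^sup>-\<^sup>1\<close> is the conjugate of \<open>z\<close>.\<close>
  define a where "a = (of_real (l 1) - \<i> * of_real (l \<i>)) / 2"
  define b where "b = (of_real (l 1) + \<i> * of_real (l \<i>)) / 2"
  have l: "of_real (l z) = a * z powi 1 + b * z powi (-1)" if "norm z = 1" for z
  proof -
    have "l z = l (Re z *\<^sub>R 1 + Im z *\<^sub>R \<i>)"
      by (rule arg_cong[where f = l]) (simp add: complex_eq_iff)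
    also have "\<dots> = Re z * l 1 + Im z * l \<i>"
      using linear.hyps by (simp add: linear_add linear_scale bounded_linear.linear)
    finally have "l z = Re z * l 1 + Im z * l \<i>" .
    moreover have "z powi (-1) = cnj z"
      using that cnj_powi_circle[of z 1] by simp
    ultimately show ?thesis
      by (simp only:) (simp add: a_def b_def complex_eq_iff field_simps)
  qed
  have "annihilates_trig (\<lambda>z. a * (f z * z powi 1) + b * (f z * z powi (-1)))"
    by (intro annihilates_trig_add annihilates_trig_scale annihilates_trig_mult_powi linear.prems)
  then show ?case
    by (rule annihilates_trig_cong) (simp add: l algebra_simps)
next
  case (const c)
  then show ?case by (rule annihilates_trig_scale)
next
  case (add p q)
  then show ?case using annihilates_trig_add[of "\<lambda>z. of_real (p z) * f z" "\<lambda>z. of_real (q z) * f z"]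
    by (simp add: distrib_right)
next
  case (mult p q)
  then show ?case
    using mult.IH(1)[OF mult.IH(2)[OF mult.prems]] by (simp add: mult.assoc)
qed

text \<open>By Stone--Weierstrass, polynomials approximate \<open>g\<close> uniformly on the circle.\<close>

lemma integral_mult_continuous_eq_0:
  fixes g :: "complex \<Rightarrow> real"
  assumes f: "annihilates_trig f" and g: "continuous_on UNIV g"
  shows "(LINT z|circle_measure. f z * of_real (g z)) = 0"
proof -
  have int: "integrable circle_measure f" using f by (simp add: annihilates_trig_def)
  define I where "I = (LINT z|circle_measure. norm (f z))"
  have "I \<ge> 0" by (simp add: I_def)
  have [measurable]: "g \<in> borel_measurable circle_measure"
    by (intro borel_imp_measurable_circle borel_measurable_continuous_onI g)
  have "norm (LINT z|circle_measure. f z * of_real (g z)) \<le> e" if "e > 0" for e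
  proof -
    define d where "d = e / (I + 1)"
    have "d > 0" using \<open>e > 0\<close> \<open>I \<ge> 0\<close> by (simp add: d_def)
    obtain p where p: "real_polynomial_function p" "\<And>z. z \<in> sphere 0 1 \<Longrightarrow> \<bar>g z - p z\<bar> < d"
      using Stone_Weierstrass_real_polynomial_function[OF compact_sphere continuous_on_subset[OF g subset_UNIV] \<open>d > 0\<close>]
      by blast
    have "continuous_on UNIV p"
      using p(1) by (simp add: continuous_on_eq_continuous_at continuous_real_polymonial_function)
    then have [measurable]: "p \<in> borel_measurable circle_measure"
      by (intro borel_imp_measurable_circle borel_measurable_continuous_onI)
    have ann: "annihilates_trig (\<lambda>z. of_real (p z) * f z)"
      by (rule annihilates_trig_mult_polynomial[OF p(1) f])
    then have p0: "integrable circle_measure (\<lambda>z. of_real (p z) * f z)"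
        "(LINT z|circle_measure. of_real (p z) * f z) = 0"
      unfolding annihilates_trig_def by (auto dest: spec[of _ 0])
    have diff: "integrable circle_measure (\<lambda>z. f z * of_real (g z - p z))"
      by (rule integrable_mult_bounded[OF int, where C = d]) (use p(2) in \<open>auto intro: less_imp_le simp del: of_real_diff\<close>)
    have "(LINT z|circle_measure. f z * of_real (g z)) =
        (LINT z|circle_measure. f z * of_real (g z - p z) + of_real (p z) * f z)"
      by (simp add: algebra_simps)
    also have "\<dots> = (LINT z|circle_measure. f z * of_real (g z - p z))"
      using p0 by (simp only: Bochner_Integration.integral_add[OF diff p0(1)]) simp
    also have "norm \<dots> \<le> (LINT z|circle_measure. norm (f z * of_real (g z - p z)))"
      by (rule integral_norm_bound)
    also have "\<dots> \<le> (LINT z|circle_measure. d * norm (f z))"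
    proof (rule integral_mono)
      fix z assume "z \<in> space circle_measure"
      then have "\<bar>g z - p z\<bar> \<le> d" using p(2)[of z] by simp
      then have "norm (f z) * \<bar>g z - p z\<bar> \<le> norm (f z) * d" by (intro mult_left_mono) auto
      then show "norm (f z * of_real (g z - p z)) \<le> d * norm (f z)"
        unfolding norm_mult norm_of_real by (simp add: mult.commute)
    qed (use int diff in auto)
    also have "\<dots> = d * I" by (simp add: I_def)
    also have "\<dots> \<le> e" using \<open>e > 0\<close> \<open>I \<ge> 0\<close> by (simp add: d_def field_simps)
    finally show ?thesis .
  qed
  then have "norm (LINT z|circle_measure. f z * of_real (g z)) \<le> 0"
    by (rule field_le_epsilon[where y = 0, simplified])
  then show ?thesis by simp
qed

lemma integral_closed_eq_0:
  assumes f: "annihilates_trig f" and C: "closed C"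
  shows "(LINT z|circle_measure. indicator C z * f z) = 0"
proof (cases "C = {}")
  case False
  have int: "integrable circle_measure f" using f by (simp add: annihilates_trig_def)
  note [measurable] = borel_measurable_integrable[OF int]
  \<comment> \<open>Continuous functions with values in \<open>[0,1]\<close> that decrease to the indicator of \<open>C\<close>.\<close>
  define s where "s n z = max 0 (1 - real n * infdist z C)" for n z
  have cont: "continuous_on UNIV (s n)" for n
    unfolding s_def by (intro continuous_intros)
  have [measurable]: "s n \<in> borel_measurable circle_measure" for n
    by (intro borel_imp_measurable_circle borel_measurable_continuous_onI cont)
  have [measurable]: "(indicator C :: complex \<Rightarrow> real) \<in> borel_measurable circle_measure"
    using C by (intro borel_imp_measurable_circle borel_measurable_indicator) simp
  have s_lim: "(\<lambda>n. s n z) \<longlonglongrightarrow> indicator C z" for z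
  proof (cases "z \<in> C")
    case True
    then show ?thesis by (simp add: s_def)
  next
    case outside: False
    then have pos: "infdist z C > 0"
      using False C by (simp add: infdist_pos_not_in_closed)
    have "\<forall>\<^sub>F n in sequentially. s n z = 0"
    proof -
      obtain N where "1 / infdist z C < real N" using reals_Archimedean2 by blast
      then have "s n z = 0" if "n \<ge> N" for n
      proof -
        have "1 < real N * infdist z C" using \<open>1 / infdist z C < real N\<close> pos by (simp add: field_simps)
        also have "\<dots> \<le> real n * infdist z C" using that pos by (intro mult_right_mono) auto
        finally show ?thesis by (simp add: s_def)
      qed
      then show ?thesis by (auto simp: eventually_sequentially)
    qed
    then show ?thesis using outside by (simp add: tendsto_eventually)
  qed
  have "(\<lambda>n. LINT z|circle_measure. f z * of_real (s n z)) \<longlonglongrightarrow> (LINT z|circle_measure. f z * of_real (indicator C z))"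
  proof (rule integral_dominated_convergence[where w = "\<lambda>z. norm (f z)"])
    show "(\<lambda>z. f z * of_real (indicator C z)) \<in> borel_measurable circle_measure"
      by measurable
    show "integrable circle_measure (\<lambda>z. norm (f z))" using int by simp
    show "AE z in circle_measure. (\<lambda>n. f z * of_real (s n z)) \<longlonglongrightarrow> f z * of_real (indicator C z)"
      by (intro AE_I2 tendsto_intros s_lim)
    show "AE z in circle_measure. norm (f z * of_real (s n z)) \<le> norm (f z)" for n
      by (rule AE_I2) (auto simp: norm_mult s_def infdist_nonneg intro!: mult_left_le)
  qed measurable
  then have "(\<lambda>n::nat. 0 :: complex) \<longlonglongrightarrow> (LINT z|circle_measure. f z * of_real (indicator C z))"
    by (simp add: integral_mult_continuous_eq_0[OF f cont])
  then have "(LINT z|circle_measure. f z * of_real (indicator C z)) = 0"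
    using LIMSEQ_unique tendsto_const by blast
  moreover have "of_real (indicator C z) = (indicator C z :: complex)" for z
    by (simp add: indicator_def)
  ultimately show ?thesis by (simp add: mult.commute)
qed simp

text \<open>The integrals of \<open>f\<close> over closed sets vanish; closed sets are stable under intersection and
  generate the Borel sets, so the integrals over all Borel sets vanish.\<close>

theorem Fourier_uniqueness:
  assumes f: "annihilates_trig f"
  shows "AE z in circle_measure. f z = 0"
proof -
  have int: "integrable circle_measure f" using f by (simp add: annihilates_trig_def)
  have sets: "B \<in> sets borel \<Longrightarrow> B \<inter> sphere 0 1 \<in> sets circle_measure" for B :: "complex set"
    by (auto simp: sets_circle_measure sets_restrict_space)
  have set_int: "set_integrable circle_measure A f" if "A \<in> sets circle_measure" for A
    unfolding set_integrable_def using that int by (rule integrable_mult_indicator)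
  have closed: "(LINT z:B \<inter> sphere 0 1|circle_measure. f z) = 0" if "closed B" for B
  proof -
    have "(LINT z:B \<inter> sphere 0 1|circle_measure. f z) = (LINT z|circle_measure. indicator B z * f z)"
      unfolding set_lebesgue_integral_def
      by (rule Bochner_Integration.integral_cong) (auto simp: indicator_def)
    then show ?thesis using integral_closed_eq_0[OF f that] by simp
  qed
  have Int_stable_closed: "Int_stable (Collect (closed :: complex set \<Rightarrow> bool))"
    by (auto simp: Int_stable_def)
  have subset_Pow_UNIV: "Collect (closed :: complex set \<Rightarrow> bool) \<subseteq> Pow UNIV" by simp
  have borel: "(LINT z:B \<inter> sphere 0 1|circle_measure. f z) = 0" if "B \<in> sigma_sets UNIV (Collect closed)" for B
    using Int_stable_closed subset_Pow_UNIV that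
  proof (induction rule: sigma_sets_induct_disjoint)
    case (basic A)
    then show ?case using closed by simp
  next
    case empty
    then show ?case by (simp add: set_lebesgue_integral_def)
  next
    case (compl A)
    then have A: "A \<in> sets borel" by (simp add: borel_eq_closed)
    have "(LINT z:UNIV \<inter> sphere 0 1|circle_measure. f z) =
        (LINT z:(A \<inter> sphere 0 1) \<union> ((UNIV - A) \<inter> sphere 0 1)|circle_measure. f z)"
      by (rule arg_cong[where f = "\<lambda>S. LINT z:S|circle_measure. f z"]) auto
    also have "\<dots> = (LINT z:A \<inter> sphere 0 1|circle_measure. f z) + (LINT z:(UNIV - A) \<inter> sphere 0 1|circle_measure. f z)"
      by (rule set_integral_Un) (auto intro!: set_int sets A)
    finally show ?case using closed[OF closed_UNIV] compl.IH by simp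
  next
    case (union A)
    then have A: "A i \<in> sets borel" for i by (auto simp: borel_eq_closed)
    have "(LINT z:(\<Union>i. A i \<inter> sphere 0 1)|circle_measure. f z) = (\<Sum>i. (LINT z:A i \<inter> sphere 0 1|circle_measure. f z))"
    proof (rule lebesgue_integral_countable_add)
      show "(A i \<inter> sphere 0 1) \<inter> (A j \<inter> sphere 0 1) = {}" if "i \<noteq> j" for i j
        using union(1) that by (auto simp: disjoint_family_on_def)
      show "set_integrable circle_measure (\<Union>i. A i \<inter> sphere 0 1) f"
        by (intro set_int sets.countable_UN) (auto intro: sets A)
    qed (intro sets A)
    then show ?case using union by (simp add: Int_UN_distrib2)
  qed
  show ?thesis
  proof (rule circle.density_zero[OF int])
    fix S assume "S \<in> sets circle_measure"
    then obtain B where "B \<in> sets borel" "S = B \<inter> sphere 0 1"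
      by (auto simp: sets_circle_measure sets_restrict_space)
    then show "set_lebesgue_integral circle_measure S f = 0"
      using borel by (simp add: borel_eq_closed)
  qed
qed

section \<open>Compactness of dual Toeplitz operators\<close>

lemma Linfty_imp_L2: "\<phi> \<in> Linfty \<Longrightarrow> \<phi> \<in> L2"
  using L2_mult_Linfty[OF _ powi_L2[of 0]] by simp

text \<open>These functions serve twice below: as the sequence to which compactness is applied, and as the
  test functions that detect the coefficients of the symbol.\<close>

lemma powi_neg_in_ominus:
  assumes "M \<subseteq> H2" "k < 0"
  shows "(\<lambda>z. z powi k) \<in> ominus L2 M"
proof -
  have "L2_inner (\<lambda>z. z powi k) f = 0" if "f \<in> M" for f
    using assms that L2_inner_commute[of "\<lambda>z. z powi k" f] by (auto simp: H2_def fourier_coeff_def)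
  then show ?thesis by (simp add: ominus_def powi_L2)
qed

text \<open>Write \<open>D\<close> for the operator and \<open>e n = z\<^sup>-\<^sup>(\<^sup>n\<^sup>+\<^sup>1\<^sup>)\<close>. The \<open>e n\<close> lie in the domain and tend weakly to zero,
  so compactness forces \<open>\<parallel>D (e n)\<parallel> \<rightarrow> 0\<close> along a subsequence. For fixed \<open>k\<close> and large \<open>n\<close> the
  character \<open>z\<^sup>k \<cdot> e n\<close> is a negative power as well, so the projection in \<open>D\<close> is invisible when testing
  against it, and the inner product of \<open>D (e n)\<close> with it is the \<open>k\<close>-th coefficient of \<open>\<phi>\<close>.\<close>

lemma compact_dual_toeplitz_imp_zero:
  assumes M: "L2_subspace M" "L2_closed M" "M \<subseteq> H2" and \<phi>: "\<phi> \<in> Linfty"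
    and compact: "compact_operator_on (ominus L2 M) (dual_toeplitz M \<phi>)"
  shows "AE z in circle_measure. \<phi> z = 0"
proof -
  let ?N = "ominus L2 M" and ?D = "dual_toeplitz M \<phi>"
  define e where "e n = (\<lambda>z::complex. z powi (- int (Suc n)))" for n
  have e_N: "e n \<in> ?N" for n
    unfolding e_def by (rule powi_neg_in_ominus[OF M(3)]) simp
  have NL2: "f \<in> L2" if "f \<in> ?N" for f using that by (simp add: ominus_def)
  have \<phi>_mult: "(\<lambda>z. \<phi> z * f z) \<in> L2" if "f \<in> ?N" for f
    by (rule L2_mult_Linfty[OF \<phi> NL2[OF that]])
  have D_N: "?D f \<in> ?N" if "f \<in> ?N" for f
    unfolding dual_toeplitz_def by (rule orth_proj_ominus(1)[OF M(1,2) \<phi>_mult[OF that]])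
  have D_inner: "L2_inner (?D f) k = L2_inner (\<lambda>z. \<phi> z * f z) k" if "f \<in> ?N" "k \<in> ?N" for f k
    unfolding dual_toeplitz_def by (rule orth_proj_ominus(2)[OF M(1,2) \<phi>_mult[OF that(1)] that(2)])
  have "\<exists>C. \<forall>n. L2_norm (e n) \<le> C"
    by (auto simp: e_def L2_norm_powi)
  with compact e_N obtain g r where g: "g \<in> ?N" and r: "strict_mono r"
    and lim: "(\<lambda>n. L2_norm (\<lambda>z. ?D (e (r n)) z - g z)) \<longlonglongrightarrow> 0"
    unfolding compact_operator_on_def by metis
  have lim_inner: "(\<lambda>n. L2_inner (?D (e (r n))) k) \<longlonglongrightarrow> L2_inner g k" if "k \<in> L2" for k
    by (intro L2_inner_tendsto_left lim that NL2 D_N e_N g)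
  \<comment> \<open>The norm limit \<open>g\<close> is also the weak limit, and the weak limit is zero.\<close>
  have "(\<lambda>n. L2_inner (?D (e (r n))) g) \<longlonglongrightarrow> 0"
  proof -
    have "L2_inner (?D (e n)) g = cnj (fourier_coeff (\<lambda>z. cnj (\<phi> z) * g z) (- int (Suc n)))" for n
    proof -
      have "L2_inner (\<lambda>z. \<phi> z * e n z) g = L2_inner (e n) (\<lambda>z. cnj (\<phi> z) * g z)"
        unfolding L2_inner_def by (simp add: mult_ac)
      then show ?thesis
        using D_inner[OF e_N g] L2_inner_commute[of "e n" "\<lambda>z. cnj (\<phi> z) * g z"]
        by (simp add: fourier_coeff_def e_def)
    qed
    moreover have "(\<lambda>n. fourier_coeff (\<lambda>z. cnj (\<phi> z) * g z) (- int (Suc (r n)))) \<longlonglongrightarrow> 0"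
    proof (rule fourier_coeff_tendsto_0)
      have "(\<lambda>z. cnj (\<phi> z)) \<in> Linfty" using \<phi> by (auto simp: Linfty_def)
      then show "(\<lambda>z. cnj (\<phi> z) * g z) \<in> L2" by (rule L2_mult_Linfty[OF _ NL2[OF g]])
      show "inj (\<lambda>n. - int (Suc (r n)))"
        using strict_mono_eq[OF r] by (simp add: inj_def)
    qed
    ultimately show ?thesis
      using tendsto_cnj[of "\<lambda>n. fourier_coeff (\<lambda>z. cnj (\<phi> z) * g z) (- int (Suc (r n)))" 0] by simp
  qed
  with lim_inner[OF NL2[OF g]] have "L2_inner g g = 0"
    using LIMSEQ_unique by blast
  then have "L2_norm g = 0" by (simp add: L2_inner_self)
  have D_lim: "(\<lambda>n. L2_norm (?D (e (r n)))) \<longlonglongrightarrow> 0"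
  proof (rule tendsto_sandwich[OF _ _ tendsto_const lim])
    have "L2_norm (?D (e (r n))) \<le> L2_norm (\<lambda>z. ?D (e (r n)) z - g z) + L2_norm g" for n
      using L2_norm_add_le[OF L2_diff[OF NL2[OF D_N[OF e_N]] NL2[OF g]] NL2[OF g], of "r n"] by simp
    then show "\<forall>\<^sub>F n in sequentially. L2_norm (?D (e (r n))) \<le> L2_norm (\<lambda>z. ?D (e (r n)) z - g z)"
      by (simp add: \<open>L2_norm g = 0\<close>)
  qed simp
  have coeff: "fourier_coeff \<phi> k = 0" for k
  proof -
    have le: "norm (fourier_coeff \<phi> k) \<le> L2_norm (?D (e n))" if "k < int (Suc n)" for n
    proof -
      let ?c = "\<lambda>z::complex. z powi (k - int (Suc n))"
      have c: "?c \<in> ?N" using that by (intro powi_neg_in_ominus[OF M(3)]) simp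
      have "L2_inner (\<lambda>z. \<phi> z * e n z) ?c = fourier_coeff \<phi> k"
        unfolding fourier_coeff_def L2_inner_def
      proof (rule Bochner_Integration.integral_cong[OF refl])
        fix z assume "z \<in> space circle_measure"
        then have z: "norm z = 1" "z \<noteq> 0" by auto
        have "e n z * z powi (- (k - int (Suc n))) = z powi (- k)"
          unfolding e_def using z(2) by (simp flip: power_int_add)
        then show "\<phi> z * e n z * cnj (?c z) = \<phi> z * cnj (z powi k)"
          by (simp only: cnj_powi_circle[OF z(1)] mult.assoc)
      qed
      then have "fourier_coeff \<phi> k = L2_inner (?D (e n)) ?c"
        using D_inner[OF e_N c] by simp
      then show ?thesis
        using L2_Cauchy_Schwarz[OF NL2[OF D_N[OF e_N]] NL2[OF c], of n] by (simp add: L2_norm_powi)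
    qed
    have "norm (fourier_coeff \<phi> k) \<le> 0"
    proof (rule tendsto_lowerbound[OF D_lim])
      have "k < int (Suc (r n))" if "n \<ge> nat k" for n
        using seq_suble[OF r, of n] that by linarith
      then show "\<forall>\<^sub>F n in sequentially. norm (fourier_coeff \<phi> k) \<le> L2_norm (?D (e (r n)))"
        using le unfolding eventually_sequentially by blast
    qed simp
    then show ?thesis by simp
  qed
  have "annihilates_trig \<phi>"
    unfolding annihilates_trig_def
  proof (intro conjI allI)
    show "integrable circle_measure \<phi>"
      using L2_integrable_mult[OF Linfty_imp_L2[OF \<phi>] powi_L2[of 0]] by simp
    fix k
    have "(LINT z|circle_measure. \<phi> z * z powi k) = fourier_coeff \<phi> (- k)"
      unfolding fourier_coeff_def L2_inner_def
    proof (rule Bochner_Integration.integral_cong[OF refl])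
      fix z assume "z \<in> space circle_measure"
      then have "norm z = 1" by simp
      from cnj_powi_circle[OF this] show "\<phi> z * z powi k = \<phi> z * cnj (z powi (- k))"
        by (simp only:) simp
    qed
    then show "(LINT z|circle_measure. \<phi> z * z powi k) = 0" by (simp add: coeff)
  qed
  then show ?thesis by (rule Fourier_uniqueness)
qed

lemma zero_imp_compact_dual_toeplitz:
  assumes "L2_subspace M" "L2_closed M" "\<phi> \<in> Linfty" and zero: "AE z in circle_measure. \<phi> z = 0"
  shows "compact_operator_on (ominus L2 M) (dual_toeplitz M \<phi>)"
proof -
  let ?N = "ominus L2 M"
  have null: "L2_norm (dual_toeplitz M \<phi> f) = 0" if "f \<in> ?N" for f
  proof -
    have \<phi>f: "(\<lambda>z. \<phi> z * f z) \<in> L2"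
      using that assms(3) by (intro L2_mult_Linfty) (auto simp: ominus_def)
    have "L2_inner (\<lambda>z. \<phi> z * f z) k = 0" for k
      unfolding L2_inner_def by (rule integral_eq_zero_AE) (use zero in auto)
    then have "L2_inner (dual_toeplitz M \<phi> f) (dual_toeplitz M \<phi> f) = 0"
      unfolding dual_toeplitz_def
      using orth_proj_ominus[OF assms(1,2) \<phi>f] by simp
    then show ?thesis by (simp add: L2_inner_self)
  qed
  have "(\<lambda>z. 0) \<in> ?N" by (simp add: ominus_def L2_zero L2_inner_def)
  then show ?thesis
    unfolding compact_operator_on_def
    using null strict_mono_id by (fastforce intro!: bexI[of _ "\<lambda>z. 0"] exI[of _ id])
qed

theorem theorem3p5:
  fixes M :: "(complex \<Rightarrow> complex) set" and h u \<phi> :: "complex \<Rightarrow> complex"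
  assumes "L2_subspace M" and "L2_closed M" and "M \<subseteq> H2" and "M \<noteq> H2"
    and "\<exists>f\<in>M. \<not> (AE z in circle_measure. f z = 0)"
    and "nearly_invariant M"
    and "inner_function u" and "\<nexists>c. AE z in circle_measure. u z = c" and "disk_ext u 0 = 0"
    and "extremal_function h M"
    and "mult_isometry_onto h (model_space u) M"
    and "\<phi> \<in> Linfty"
  shows "compact_operator_on (ominus L2 M) (dual_toeplitz M \<phi>) \<longleftrightarrow>
    (AE z in circle_measure. \<phi> z = 0)"
proof
  assume "compact_operator_on (ominus L2 M) (dual_toeplitz M \<phi>)"
  with assms(1-3) \<open>\<phi> \<in> Linfty\<close> show "AE z in circle_measure. \<phi> z = 0"
    by (rule compact_dual_toeplitz_imp_zero)
next
  assume "AE z in circle_measure. \<phi> z = 0"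
  with assms(1,2) \<open>\<phi> \<in> Linfty\<close> show "compact_operator_on (ominus L2 M) (dual_toeplitz M \<phi>)"
    by (rule zero_imp_compact_dual_toeplitz)
qed

end
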